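(* Consider solving $Ax=0$ using Anderson acceleration AA(1) applied to the linear fixed-point iteration function $q(x)=Mx$ with $M=I-A$ and nonzero initial guess $x_0\in\mathbb{R}^n$. Let $r_k(x_0)$ denote the $k$-th AA(1) residual generated from the initial guess $x_0$. Then, for any nonzero scalar $\alpha$, the AA(1) residuals have the following property: $$\lim_{k\to\infty}\|r_k(x_0)\|^{\frac1k}=\lim_{k\to\infty}\|r_k(\alpha x_0)\|^{\frac1k}.$$
   Context: Setting: $A\in\mathbb{R}^{n\times n}$ is nonsingular, $M=I-A\neq0$, $q(x)=Mx$. $\|\cdot\|$ is the 2-norm. The residuals are $r_k=x_k-q(x_k)=Ax_k$. AA(1): given $x_0\in\mathbb{R}^n$, set $x_1=q(x_0)$ and for $k\ge1$ $$x_{k+1}=(1+\beta_k)q(x_k)-\beta_kq(x_{k-1}),\qquad \beta_k=\frac{-r_k^T(r_k-r_{k-1})}{\|r_k-r_{k-1}\|^2}\ \text{ if } r_k\ne r_{k-1},$$ and $\beta_k=0$ if $r_k=r_{k-1}$. Equivalently, the residuals are given by $r_{k+1}=p_{k+1}(M)\,r_0$, where $p_0(\lambda)=1$, $p_1(\lambda)=\lambda$ and $p_{k+1}(\lambda)=(1+\beta_k)\lambda p_k(\lambda)-\beta_k\lambda p_{k-1}(\lambda)$ for $k\ge1$. The notation $r_k(x_0)$ and $r_k(\alpha x_0)$ indicates the dependence of $r_k$ on the initial guess. *)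

theory Defs
  imports "HOL-Analysis.Analysis"
begin

definition fp_residual :: "('a::real_inner \<Rightarrow> 'a) \<Rightarrow> 'a \<Rightarrow> 'a" where
  "fp_residual q x = x - q x"

text \<open>The first argument is the current residual, the second the previous one.\<close>

definition aa1_coeff :: "'a::real_inner \<Rightarrow> 'a \<Rightarrow> real" where
  "aa1_coeff r r' =
     (if r = r' then 0 else - (r \<bullet> (r - r')) / (norm (r - r'))\<^sup>2)"

fun aa1 :: "('a::real_inner \<Rightarrow> 'a) \<Rightarrow> 'a \<Rightarrow> nat \<Rightarrow> 'a" where
  "aa1 q x0 0 = x0"
| "aa1 q x0 (Suc 0) = q x0"
| "aa1 q x0 (Suc (Suc k)) =
     (let x = aa1 q x0 (Suc k);
          x' = aa1 q x0 k;
          \<beta> = aa1_coeff (fp_residual q x) (fp_residual q x')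
      in (1 + \<beta>) *\<^sub>R q x - \<beta> *\<^sub>R q x')"

definition aa1_residual :: "('a::real_inner \<Rightarrow> 'a) \<Rightarrow> 'a \<Rightarrow> nat \<Rightarrow> 'a" where
  "aa1_residual q x0 k = fp_residual q (aa1 q x0 k)"

end

theory Submission
  imports Defs
begin

text \<open>
  Scaling the initial guess of AA(1) for a linear map \<open>q\<close> scales every iterate by the same factor.
  The coefficient \<open>\<beta>\<^sub>k\<close> is a quotient of two quadratic forms in the residuals, hence
  homogeneous of degree zero: it does not see the scaling, and once \<open>\<beta>\<^sub>k\<close> agrees for both
  runs, the recurrence is linear in the iterates. So \<open>r\<^sub>k(\<alpha> x\<^sub>0) = \<alpha> r\<^sub>k(x\<^sub>0)\<close>
  (lemma \<open>aa1_residual_scaleR\<close>), and the two root sequences differ by the factor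
  \<open>\<bar>\<alpha>\<bar>\<^bsup>1/k\<^esup>\<close>, which tends to 1 (lemma \<open>tendsto_root_mult_const_iff\<close>).
  The two sequences therefore have exactly the same limits. This gives both the equivalence of
  convergence and the equality of the values of \<^const>\<open>lim\<close>, the latter also for divergent
  sequences, because \<^const>\<open>lim\<close> depends only on the set of limits.
\<close>

text \<open>
  Numerator and denominator both pick up the factor \<open>a\<^sup>2\<close>; the assumption \<open>a \<noteq> 0\<close> makes the
  degenerate case, equal residuals, occur for both pairs of arguments or for neither.
\<close>

lemma aa1_coeff_scaleR:
  assumes "a \<noteq> 0"
  shows "aa1_coeff (a *\<^sub>R r) (a *\<^sub>R r') = aa1_coeff r r'"
proof -
  have "(a *\<^sub>R r) \<bullet> (a *\<^sub>R r - a *\<^sub>R r') = a\<^sup>2 * (r \<bullet> (r - r'))"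
    by (simp add: scaleR_diff_right [symmetric] power2_eq_square)
  moreover have "(norm (a *\<^sub>R r - a *\<^sub>R r'))\<^sup>2 = a\<^sup>2 * (norm (r - r'))\<^sup>2"
    by (simp add: scaleR_diff_right [symmetric] power_mult_distrib)
  ultimately show ?thesis
    using assms by (simp add: aa1_coeff_def)
qed

lemma fp_residual_scaleR:
  assumes "linear q"
  shows "fp_residual q (a *\<^sub>R x) = a *\<^sub>R fp_residual q x"
  by (simp add: fp_residual_def linear_scale [OF assms] scaleR_diff_right)

lemma aa1_scaleR:
  assumes q: "linear q" and a: "a \<noteq> 0"
  shows "aa1 q (a *\<^sub>R x0) k = a *\<^sub>R aa1 q x0 k"
proof (induction k rule: less_induct)
  case (less k)
  consider "k = 0" | "k = Suc 0" | j where "k = Suc (Suc j)"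
    by (metis not0_implies_Suc)
  then show ?case
  proof cases
    case 3
    with less have IH: "aa1 q (a *\<^sub>R x0) (Suc j) = a *\<^sub>R aa1 q x0 (Suc j)"
      "aa1 q (a *\<^sub>R x0) j = a *\<^sub>R aa1 q x0 j"
      by simp_all
    show ?thesis
      unfolding 3 aa1.simps Let_def IH
      by (simp add: fp_residual_scaleR [OF q] aa1_coeff_scaleR [OF a] linear_scale [OF q]
          scaleR_diff_right mult.commute)
  qed (simp_all add: linear_scale [OF q])
qed

lemma aa1_residual_scaleR:
  assumes "linear q" and "a \<noteq> 0"
  shows "aa1_residual q (a *\<^sub>R x0) k = a *\<^sub>R aa1_residual q x0 k"
  by (simp add: aa1_residual_def aa1_scaleR [OF assms] fp_residual_scaleR [OF assms(1)])

text \<open>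
  The factor contributes \<open>c\<^bsup>1/k\<^esup> \<longlonglongrightarrow> 1\<close>; multiplying by \<open>c\<close> can be undone by multiplying by
  \<open>1/c\<close>, so one implication, for arbitrary \<open>c\<close> and \<open>f\<close>, yields both.
\<close>

lemma tendsto_root_mult_const_iff:
  fixes f :: "nat \<Rightarrow> real"
  assumes "c > 0"
  shows "(\<lambda>k. root k (c * f k)) \<longlonglongrightarrow> L \<longleftrightarrow> (\<lambda>k. root k (f k)) \<longlonglongrightarrow> L"
proof -
  have scaled: "(\<lambda>k. root k (d * g k)) \<longlonglongrightarrow> L"
    if "d > 0" and "(\<lambda>k. root k (g k)) \<longlonglongrightarrow> L" for d and g :: "nat \<Rightarrow> real"
    using tendsto_mult [OF LIMSEQ_root_const [OF that(1)] that(2)]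
    by (simp add: real_root_mult)
  show ?thesis
    using scaled [of c f] scaled [of "1 / c" "\<lambda>k. c * f k"] assms by auto
qed

theorem proposition3p10:
  fixes A M :: "real ^ 'n ^ 'n"
    and q :: "real ^ 'n \<Rightarrow> real ^ 'n"
    and x0 :: "real ^ 'n"
    and \<alpha> :: real
  assumes "invertible A"
    and "M = mat 1 - A"
    and "M \<noteq> 0"
    and "\<And>x. q x = M *v x"
    and "x0 \<noteq> 0"
    and "\<alpha> \<noteq> 0"
  shows "(convergent (\<lambda>k. root k (norm (aa1_residual q x0 k)))
            \<longleftrightarrow> convergent (\<lambda>k. root k (norm (aa1_residual q (\<alpha> *\<^sub>R x0) k))))
       \<and> lim (\<lambda>k. root k (norm (aa1_residual q x0 k)))
          = lim (\<lambda>k. root k (norm (aa1_residual q (\<alpha> *\<^sub>R x0) k)))"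
proof -
  have "linear q"
    using assms(4) by (simp add: linear_iff matrix_vector_right_distrib scaleR_matrix_vector_assoc
        matrix_vector_mult_scaleR)
  then have "norm (aa1_residual q (\<alpha> *\<^sub>R x0) k) = \<bar>\<alpha>\<bar> * norm (aa1_residual q x0 k)" for k
    using assms(6) by (simp add: aa1_residual_scaleR)
  then have "(\<lambda>k. root k (norm (aa1_residual q x0 k))) \<longlonglongrightarrow> L \<longleftrightarrow>
      (\<lambda>k. root k (norm (aa1_residual q (\<alpha> *\<^sub>R x0) k))) \<longlonglongrightarrow> L" for L
    using assms(6) by (simp add: tendsto_root_mult_const_iff)
  then show ?thesis
    by (simp add: convergent_def lim_def)
qed

end
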